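(* Let $\mathcal Q^{\mathsf{TV}}_\varepsilon$ denote the family of $\varepsilon$-total variation private channels, and for $t>0$ consider the collection of uniform distributions on $[0,\theta]$ with $\theta\le t$. Then, in absolute value error, $$\inf_{Q\in\mathcal Q^{\mathsf{TV}}_\varepsilon}\ \sup_{0<\theta\le t}\ \mathbb E_{\theta,Q}\left[\big|\widehat\theta(X_{1:n})-\theta\big|\right]\ \ge\ \frac{1}{32}\,\frac{t}{n\varepsilon}.$$
   Context: For each $\theta\in(0,t]$, $X_1,\dots,X_n$ are drawn i.i.d. from the uniform distribution on $[0,\theta]$; conditionally on $X_{1:n}=(X_1,\dots,X_n)$, the estimator $\widehat\theta(X_{1:n})\in\mathbb R_+$ is drawn from $Q(\cdot\mid X_{1:n})$. $\mathbb E_{\theta,Q}$ is expectation over both. A channel $Q$ is a Markov kernel from $\mathbb R_+^n$ to $\mathbb R_+$, where $\mathbb R_+=[0,\infty)$. A channel $Q$ is $\varepsilon$-total variation private if $|Q(A\mid x_{1:n})-Q(A\mid x'_{1:n})|\le\varepsilon$ for all measurable $A$ and all $x_{1:n},x'_{1:n}$ differing in only one observation.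
   Formalization: The bound is proved under the added assumption nε ≥ 1/14 (with n ≥ 1, ε > 0); some such condition is needed, since for nε < 1/16 the constant estimator t/2 is ε-total variation private and has worst-case error t/2 < t/(32nε). *)

theory Defs
  imports "HOL-Probability.Probability"
begin

definition Rplus :: "real measure" where
  "Rplus = restrict_space borel {0..}"

text \<open>Points of \<open>Rplus\<^sup>n\<close> are functions on \<open>{..<n}\<close>, \<open>undefined\<close> elsewhere.\<close>

definition samples :: "nat \<Rightarrow> (nat \<Rightarrow> real) measure" where
  "samples n = (\<Pi>\<^sub>M i\<in>{..<n}. Rplus)"

definition channels :: "nat \<Rightarrow> ((nat \<Rightarrow> real) \<Rightarrow> real measure) set" where
  "channels n = samples n \<rightarrow>\<^sub>M prob_algebra Rplus"

definition tv_private :: "nat \<Rightarrow> real \<Rightarrow> ((nat \<Rightarrow> real) \<Rightarrow> real measure) \<Rightarrow> bool" where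
  "tv_private n \<epsilon> Q \<longleftrightarrow>
     (\<forall>A\<in>sets Rplus. \<forall>x\<in>space (samples n). \<forall>x'\<in>space (samples n).
        card {i\<in>{..<n}. x i \<noteq> x' i} = 1 \<longrightarrow>
        \<bar>measure (Q x) A - measure (Q x') A\<bar> \<le> \<epsilon>)"

definition tv_private_channels :: "nat \<Rightarrow> real \<Rightarrow> ((nat \<Rightarrow> real) \<Rightarrow> real measure) set" where
  "tv_private_channels n \<epsilon> = {Q \<in> channels n. tv_private n \<epsilon> Q}"

definition unif :: "real \<Rightarrow> real measure" where
  "unif \<theta> = restrict_space (uniform_measure lborel {0..\<theta>}) {0..}"

definition sample_law :: "nat \<Rightarrow> real \<Rightarrow> (nat \<Rightarrow> real) measure" where
  "sample_law n \<theta> = (\<Pi>\<^sub>M i\<in>{..<n}. unif \<theta>)"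

text \<open>The error is nonnegative and its expectation may be infinite, so it is taken in
  \<^typ>\<open>ennreal\<close>; a real-valued Bochner integral would be \<open>0\<close> in that case.\<close>

definition risk :: "nat \<Rightarrow> ((nat \<Rightarrow> real) \<Rightarrow> real measure) \<Rightarrow> real \<Rightarrow> ennreal" where
  "risk n Q \<theta> = (\<integral>\<^sup>+ x. (\<integral>\<^sup>+ y. ennreal \<bar>y - \<theta>\<bar> \<partial>Q x) \<partial>sample_law n \<theta>)"

lemma sets_unif: "sets (unif \<theta>) = sets Rplus"
  unfolding unif_def Rplus_def by (rule sets_restrict_space_cong) simp

lemma prob_space_unif:
  assumes "\<theta> > 0"
  shows "prob_space (unif \<theta>)"
proof -
  interpret prob_space "uniform_measure lborel {0..\<theta>}"
    by (rule prob_space_uniform_measure) (use assms in auto)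
  have "AE x in uniform_measure lborel {0..\<theta>}. x \<in> {0..}"
    using assms by (intro AE_uniform_measureI) auto
  then have "emeasure (uniform_measure lborel {0..\<theta>}) {0..} = 1"
    by (subst emeasure_eq_1_AE) auto
  then show ?thesis
    unfolding unif_def
    by (intro prob_space_restrict_space) auto
qed

lemma sets_sample_law: "sets (sample_law n \<theta>) = sets (samples n)"
  unfolding sample_law_def samples_def by (rule sets_PiM_cong) (simp_all add: sets_unif)

end

theory Submission
  imports Defs
begin

text \<open>
  Le Cam's two-point method with \<open>\<theta>\<^sub>0 = (1 - \<delta>) t\<close> and \<open>\<theta>\<^sub>1 = t\<close>. The law \<open>unif \<theta>\<^sub>1\<close> is the mixture of
  \<open>unif \<theta>\<^sub>0\<close>, with weight \<open>1 - \<delta>\<close>, and of the uniform law on \<open>(\<theta>\<^sub>0, \<theta>\<^sub>1]\<close>, so replacing one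
  observation from the former by one from the latter moves the expectation of a function with
  differences at most \<open>\<epsilon>\<close> by at most \<open>\<delta> \<epsilon>\<close>. Hence the output laws under \<open>\<theta>\<^sub>0\<close> and \<open>\<theta>\<^sub>1\<close> are within
  \<open>n \<epsilon> \<delta>\<close> in total variation, and the two risks add up to at least \<open>\<delta> t (1 - n \<epsilon> \<delta>)\<close>. Take
  \<open>\<delta> = 1 / (2 n \<epsilon>)\<close> if \<open>n \<epsilon> > 1/2\<close>. Otherwise take \<open>\<delta> = 19/20\<close>, which suffices
  as \<open>\<delta> n \<epsilon> (1 - n \<epsilon> \<delta>) \<ge> 19/20 \<cdot> 13/196 > 1/16\<close> for \<open>1/14 \<le> n \<epsilon> \<le> 1/2\<close>.
\<close>

section \<open>From total variation to expectations of functions with values in [0, 1]\<close>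

text \<open>Each value \<open>f y\<close> is the length of the set of levels \<open>u\<close> in
  \<open>{0..1}\<close> strictly below it; Tonelli then exchanges \<open>u\<close> and
  \<open>y\<close>.\<close>

lemma nn_integral_layer_cake_unit:
  assumes M: "sigma_finite_measure M" and f [measurable]: "f \<in> borel_measurable M"
    and f01: "\<And>y. 0 \<le> f y \<and> f y \<le> (1::real)"
  shows "(\<integral>\<^sup>+ y. ennreal (f y) \<partial>M)
           = (\<integral>\<^sup>+ u. emeasure M {y\<in>space M. u < f y} * indicator {0..1} u \<partial>lborel)"
proof -
  interpret M: sigma_finite_measure M by fact
  interpret pair_sigma_finite M lborel ..
  have layer: "ennreal (f y)
      = (\<integral>\<^sup>+ u. indicator {y\<in>space M. u < f y} y * indicator {0..1} u \<partial>lborel)"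
    if "y \<in> space M" for y
  proof -
    have "(\<integral>\<^sup>+ u. indicator {y\<in>space M. u < f y} y * indicator {0..1} u \<partial>lborel)
        = (\<integral>\<^sup>+ u. indicator {0..<f y} u \<partial>lborel)"
      using that f01[of y] by (intro nn_integral_cong) (auto split: split_indicator)
    also have "\<dots> = ennreal (f y)"
      using f01[of y] by simp
    finally show ?thesis by simp
  qed
  have "(\<integral>\<^sup>+ y. ennreal (f y) \<partial>M)
      = (\<integral>\<^sup>+ y. \<integral>\<^sup>+ u. indicator {y\<in>space M. u < f y} y * indicator {0..1} u \<partial>lborel \<partial>M)"
    using layer by (intro nn_integral_cong) simp
  also have "\<dots> = (\<integral>\<^sup>+ u. \<integral>\<^sup>+ y. indicator {y\<in>space M. u < f y} y * indicator {0..1} u \<partial>M \<partial>lborel)"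
    by (rule Fubini'[symmetric]) (unfold indicator_def mem_Collect_eq, measurable)
  also have "\<dots> = (\<integral>\<^sup>+ u. emeasure M {y\<in>space M. u < f y} * indicator {0..1} u \<partial>lborel)"
    by (intro nn_integral_cong) (simp add: nn_integral_multc)
  finally show ?thesis .
qed

text \<open>Total variation controls sets only, so \<open>f\<close> is cut into its superlevel sets.
  Each costs at most \<open>e\<close>, and the levels fill an interval of length 1, so the total
  cost is again \<open>e\<close>.\<close>

lemma nn_integral_le_tv:
  assumes "prob_space M" "prob_space N" and sets: "sets M = sets N" and "0 \<le> e"
    and f: "f \<in> borel_measurable M" and f01: "\<And>y. 0 \<le> f y \<and> f y \<le> (1::real)"
    and tv: "\<And>A. A \<in> sets M \<Longrightarrow> measure M A \<le> measure N A + e"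
  shows "(\<integral>\<^sup>+ y. ennreal (f y) \<partial>M) \<le> (\<integral>\<^sup>+ y. ennreal (f y) \<partial>N) + ennreal e"
proof -
  interpret M: prob_space M by fact
  interpret N: prob_space N by fact
  have fN [measurable]: "f \<in> borel_measurable N"
    using f sets measurable_cong_sets by blast
  note f [measurable]
  have space: "space M = space N"
    using sets by (rule sets_eq_imp_space_eq)
  \<comment> \<open>Measurability in the level \<open>u\<close> is what later allows the integral of
    the sum to be split.\<close>
  have meas [measurable]: "(\<lambda>u::real. emeasure N {y\<in>space N. u < f y}) \<in> borel_measurable lborel"
  proof -
    have "(\<lambda>u. \<integral>\<^sup>+ y. indicator {y\<in>space N. u < f y} y \<partial>N) \<in> borel_measurable lborel"
      by (rule N.borel_measurable_nn_integral) (unfold indicator_def mem_Collect_eq, measurable)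
    then show ?thesis by (simp add: nn_integral_indicator)
  qed
  have le: "emeasure M {y\<in>space M. u < f y} \<le> emeasure N {y\<in>space N. u < f y} + ennreal e" for u
  proof -
    have "measure M {y\<in>space M. u < f y} \<le> measure N {y\<in>space N. u < f y} + e"
      using tv[of "{y\<in>space M. u < f y}"] by (simp add: space[symmetric])
    then show ?thesis
      using \<open>0 \<le> e\<close> by (simp add: M.emeasure_eq_measure N.emeasure_eq_measure ennreal_plus[symmetric] del: ennreal_plus)
  qed
  have "(\<integral>\<^sup>+ y. ennreal (f y) \<partial>M)
      = (\<integral>\<^sup>+ u. emeasure M {y\<in>space M. u < f y} * indicator {0..1} u \<partial>lborel)"
    using f f01 by (intro nn_integral_layer_cake_unit) (auto intro: M.sigma_finite_measure_axioms)
  also have "\<dots> \<le> (\<integral>\<^sup>+ u. emeasure N {y\<in>space N. u < f y} * indicator {0..1} u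
        + ennreal e * indicator {0..1} u \<partial>lborel)"
    using le by (intro nn_integral_mono) (auto split: split_indicator)
  also have "\<dots> = (\<integral>\<^sup>+ u. emeasure N {y\<in>space N. u < f y} * indicator {0..1} u \<partial>lborel)
        + ennreal e"
    by (simp add: nn_integral_add nn_integral_cmult_indicator)
  also have "\<dots> = (\<integral>\<^sup>+ y. ennreal (f y) \<partial>N) + ennreal e"
    using fN f01 by (subst nn_integral_layer_cake_unit) (auto intro: N.sigma_finite_measure_axioms)
  finally show ?thesis .
qed

section \<open>Enlarging the range of a single uniform observation\<close>

lemma space_unif [simp]: "space (unif \<theta>) = {0..}"
  by (simp add: unif_def space_restrict_space)

text \<open>Since \<open>g\<close> is measurable on \<open>Rplus\<close> only, the indicator of
  \<open>{0..}\<close> extends it by zero to the whole line before the density formula is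
  used.\<close>

lemma nn_integral_unif:
  assumes "\<theta> > 0" and g: "g \<in> borel_measurable Rplus"
  shows "(\<integral>\<^sup>+ y. g y \<partial>unif \<theta>) = (\<integral>\<^sup>+ y. (g y * indicator {0..} y) * indicator {0..\<theta>} y \<partial>lborel) / ennreal \<theta>"
proof -
  have [measurable]: "(\<lambda>y. g y * indicator {0..} y) \<in> borel_measurable borel"
    using g unfolding Rplus_def
    by (subst (asm) borel_measurable_restrict_space_iff_ennreal) auto
  have "(\<integral>\<^sup>+ y. g y \<partial>unif \<theta>) = (\<integral>\<^sup>+ y. g y * indicator {0..} y \<partial>uniform_measure lborel {0..\<theta>})"
    unfolding unif_def by (subst nn_integral_restrict_space) auto
  also have "\<dots> = (\<integral>\<^sup>+ y. (g y * indicator {0..} y) * indicator {0..\<theta>} y \<partial>lborel) / ennreal \<theta>"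
    using \<open>\<theta> > 0\<close> by (subst nn_integral_uniform_measure) auto
  finally show ?thesis .
qed

text \<open>Under \<open>\<theta>\<^sub>1\<close>, the part of the mass in
  \<open>{0..\<theta>\<^sub>0}\<close> still averages to the \<open>\<theta>\<^sub>0\<close>-mean of
  \<open>g\<close>. Only the remaining fraction
  \<open>1 - \<theta>\<^sub>0 / \<theta>\<^sub>1\<close> can lie above that mean, and by at most
  \<open>e\<close>.\<close>

lemma nn_integral_unif_le:
  assumes "0 < \<theta>\<^sub>0" "\<theta>\<^sub>0 \<le> \<theta>\<^sub>1" "0 \<le> e" and g: "g \<in> borel_measurable Rplus"
    and osc: "\<And>y y'. 0 \<le> y \<Longrightarrow> 0 \<le> y' \<Longrightarrow> g y \<le> g y' + ennreal e"
  shows "(\<integral>\<^sup>+ y. g y \<partial>unif \<theta>\<^sub>1) \<le> (\<integral>\<^sup>+ y. g y \<partial>unif \<theta>\<^sub>0) + ennreal ((1 - \<theta>\<^sub>0 / \<theta>\<^sub>1) * e)"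
proof -
  define G where "G y = g y * indicator {0..} y" for y
  have [measurable]: "G \<in> borel_measurable borel"
    using g unfolding Rplus_def G_def
    by (subst (asm) borel_measurable_restrict_space_iff_ennreal) auto
  define c where "c = (\<integral>\<^sup>+ y. g y \<partial>unif \<theta>\<^sub>0)"
  interpret prob_space "unif \<theta>\<^sub>0"
    using assms by (intro prob_space_unif)
  have [measurable]: "g \<in> borel_measurable (unif \<theta>\<^sub>0)"
    using g sets_unif measurable_cong_sets by blast
  \<comment> \<open>Averaging \<open>osc\<close> over \<open>y'\<close> replaces the arbitrary
    comparison point by the mean \<open>c\<close>.\<close>
  have bound: "g y \<le> c + ennreal e" if "0 \<le> y" for y
  proof -
    have "g y = (\<integral>\<^sup>+ y'. g y \<partial>unif \<theta>\<^sub>0)"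
      using emeasure_space_1 by simp
    also have "\<dots> \<le> (\<integral>\<^sup>+ y'. g y' + ennreal e \<partial>unif \<theta>\<^sub>0)"
      using osc that by (intro nn_integral_mono) auto
    also have "\<dots> = c + ennreal e"
      using emeasure_space_1 unfolding c_def by (subst nn_integral_add) auto
    finally show ?thesis .
  qed
  have c: "(\<integral>\<^sup>+ y. G y * indicator {0..\<theta>\<^sub>0} y \<partial>lborel) = ennreal \<theta>\<^sub>0 * c"
    using assms unfolding c_def G_def
    by (subst nn_integral_unif) (auto simp: ennreal_times_divide ennreal_mult_divide_eq mult.commute[of "ennreal _"])
  \<comment> \<open>Without normalisation the old interval contributes exactly
    \<open>\<theta>\<^sub>0 * c\<close>, and the new piece at most \<open>c + e\<close> times its
    length; division by \<open>\<theta>\<^sub>1\<close> comes last.\<close>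
  have "(\<integral>\<^sup>+ y. G y * indicator {0..\<theta>\<^sub>1} y \<partial>lborel)
      \<le> (\<integral>\<^sup>+ y. G y * indicator {0..\<theta>\<^sub>0} y + (c + ennreal e) * indicator {\<theta>\<^sub>0<..\<theta>\<^sub>1} y \<partial>lborel)"
    using bound assms by (intro nn_integral_mono) (auto simp: G_def split: split_indicator)
  also have "\<dots> = ennreal \<theta>\<^sub>0 * c + (c + ennreal e) * ennreal (\<theta>\<^sub>1 - \<theta>\<^sub>0)"
    using assms by (subst nn_integral_add) (auto simp: c nn_integral_cmult_indicator)
  also have "\<dots> = (ennreal \<theta>\<^sub>0 + ennreal (\<theta>\<^sub>1 - \<theta>\<^sub>0)) * c + ennreal (\<theta>\<^sub>1 - \<theta>\<^sub>0) * ennreal e"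
    by (simp add: algebra_simps)
  also have "ennreal \<theta>\<^sub>0 + ennreal (\<theta>\<^sub>1 - \<theta>\<^sub>0) = ennreal \<theta>\<^sub>1"
    using assms by (simp add: ennreal_plus[symmetric] del: ennreal_plus)
  also have "ennreal (\<theta>\<^sub>1 - \<theta>\<^sub>0) * ennreal e = ennreal \<theta>\<^sub>1 * ennreal ((1 - \<theta>\<^sub>0 / \<theta>\<^sub>1) * e)"
  proof -
    have "(\<theta>\<^sub>1 - \<theta>\<^sub>0) * e = \<theta>\<^sub>1 * ((1 - \<theta>\<^sub>0 / \<theta>\<^sub>1) * e)"
      using assms by (simp add: field_simps)
    then show ?thesis
      using assms by (simp add: ennreal_mult'[symmetric])
  qed
  finally have le: "(\<integral>\<^sup>+ y. G y * indicator {0..\<theta>\<^sub>1} y \<partial>lborel)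
      \<le> (c + ennreal ((1 - \<theta>\<^sub>0 / \<theta>\<^sub>1) * e)) * ennreal \<theta>\<^sub>1"
    by (simp add: algebra_simps)
  have "(\<integral>\<^sup>+ y. g y \<partial>unif \<theta>\<^sub>1) = (\<integral>\<^sup>+ y. G y * indicator {0..\<theta>\<^sub>1} y \<partial>lborel) / ennreal \<theta>\<^sub>1"
    using assms unfolding G_def by (intro nn_integral_unif) auto
  also have "\<dots> \<le> ((c + ennreal ((1 - \<theta>\<^sub>0 / \<theta>\<^sub>1) * e)) * ennreal \<theta>\<^sub>1) / ennreal \<theta>\<^sub>1"
    by (intro divide_right_mono_ennreal le)
  also have "\<dots> = c + ennreal ((1 - \<theta>\<^sub>0 / \<theta>\<^sub>1) * e)"
    using assms by (intro ennreal_mult_divide_eq) auto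
  finally show ?thesis unfolding c_def .
qed

section \<open>Changing the law of all observations, one coordinate at a time\<close>

text \<open>Changing the law of the new coordinate \<open>i\<close> costs one single-observation
  term and leaves \<open>h\<close>, where \<open>i\<close> is averaged under
  \<open>\<theta>\<^sub>0\<close>. As \<open>h\<close> keeps the difference bound \<open>e\<close>
  in the other coordinates, the induction hypothesis handles them, and the costs add up.\<close>

lemma nn_integral_PiM_unif_le:
  assumes "finite I" and "0 < \<theta>\<^sub>0" "\<theta>\<^sub>0 \<le> \<theta>\<^sub>1" "0 \<le> e"
    and "f \<in> borel_measurable (\<Pi>\<^sub>M i\<in>I. Rplus)"
    and "\<And>x i y. x \<in> space (\<Pi>\<^sub>M i\<in>I. Rplus) \<Longrightarrow> i \<in> I \<Longrightarrow> 0 \<le> y \<Longrightarrow> f (x(i := y)) \<le> f x + ennreal e"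
  shows "(\<integral>\<^sup>+ x. f x \<partial>(\<Pi>\<^sub>M i\<in>I. unif \<theta>\<^sub>1))
     \<le> (\<integral>\<^sup>+ x. f x \<partial>(\<Pi>\<^sub>M i\<in>I. unif \<theta>\<^sub>0)) + ennreal (real (card I) * ((1 - \<theta>\<^sub>0 / \<theta>\<^sub>1) * e))"
  using assms(1,5,6)
proof (induction I arbitrary: f)
  case empty
  then show ?case by (simp add: PiM_empty)
next
  case (insert i I)
  interpret U0: prob_space "unif \<theta>\<^sub>0"
    using assms by (intro prob_space_unif) auto
  interpret U1: prob_space "unif \<theta>\<^sub>1"
    using assms by (intro prob_space_unif) auto
  interpret P0: product_prob_space "\<lambda>_. unif \<theta>\<^sub>0" ..
  interpret P1: product_prob_space "\<lambda>_. unif \<theta>\<^sub>1" ..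
  have P1_prob: "prob_space (\<Pi>\<^sub>M i\<in>I. unif \<theta>\<^sub>1)"
    by (rule prob_space_PiM) (rule U1.prob_space_axioms)
  have sets: "sets (\<Pi>\<^sub>M i\<in>J. unif \<theta>) = sets (\<Pi>\<^sub>M i\<in>J. Rplus)" for J \<theta>
    by (rule sets_PiM_cong) (simp_all add: sets_unif)
  have meas: "f \<in> borel_measurable (\<Pi>\<^sub>M i\<in>insert i I. unif \<theta>)" for \<theta>
    using insert.prems(1) measurable_cong_sets[OF sets refl] by blast
  let ?d = "(1 - \<theta>\<^sub>0 / \<theta>\<^sub>1) * e"
  have d: "0 \<le> ?d"
    using assms by (intro mult_nonneg_nonneg) auto
  have spI: "space (\<Pi>\<^sub>M i\<in>J. Rplus) = (\<Pi>\<^sub>E i\<in>J. {0..})" for J :: "'a set"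
    by (simp add: space_PiM Rplus_def space_restrict_space)
  define h where "h x = (\<integral>\<^sup>+ y. f (x(i := y)) \<partial>unif \<theta>\<^sub>0)" for x
  have pair: "(\<lambda>(x, y). f (x(i := y))) \<in> borel_measurable ((\<Pi>\<^sub>M i\<in>I. Rplus) \<Otimes>\<^sub>M unif \<theta>\<^sub>0)"
  proof -
    have "(\<lambda>(x, y). f (x(i := y))) \<in> borel_measurable ((\<Pi>\<^sub>M i\<in>I. Rplus) \<Otimes>\<^sub>M Rplus)"
      using measurable_compose[OF measurable_add_dim insert.prems(1)]
      by (simp add: case_prod_beta' fun_upd_def)
    then show ?thesis
      using measurable_cong_sets[OF sets_pair_measure_cong[OF refl sets_unif] refl] by blast
  qed
  have h_meas: "h \<in> borel_measurable (\<Pi>\<^sub>M i\<in>I. Rplus)"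
    unfolding h_def using U0.borel_measurable_nn_integral[OF pair] .
  have h_meas1: "h \<in> borel_measurable (\<Pi>\<^sub>M i\<in>I. unif \<theta>\<^sub>1)"
    using h_meas measurable_cong_sets[OF sets refl] by blast
  have upd_sp: "x(i := y) \<in> space (\<Pi>\<^sub>M i\<in>insert i I. Rplus)"
    if "x \<in> space (\<Pi>\<^sub>M i\<in>I. Rplus)" "0 \<le> y" for x y
    using that by (auto simp: spI PiE_def Pi_def extensional_def)
  have f_upd: "(\<lambda>y. f (x(i := y))) \<in> borel_measurable Rplus"
    if "x \<in> space (\<Pi>\<^sub>M i\<in>I. Rplus)" for x
  proof -
    have "(\<lambda>y. x(i := y)) \<in> Rplus \<rightarrow>\<^sub>M (\<Pi>\<^sub>M i\<in>insert i I. Rplus)"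
      using measurable_compose[OF measurable_Pair1'[OF that, of Rplus] measurable_add_dim]
      by simp
    then show ?thesis
      by (rule measurable_compose[OF _ insert.prems(1)])
  qed
  have inner: "(\<integral>\<^sup>+ y. f (x(i := y)) \<partial>unif \<theta>\<^sub>1) \<le> h x + ennreal ?d"
    if x: "x \<in> space (\<Pi>\<^sub>M i\<in>I. Rplus)" for x
    unfolding h_def
  proof (rule nn_integral_unif_le)
    fix y y' :: real assume y: "0 \<le> y" and y': "0 \<le> y'"
    \<comment> \<open>The difference bound needs a base point in the larger product. As
      \<open>x\<close> is \<open>undefined\<close> at \<open>i\<close>, the point
      \<open>x(i := y')\<close> serves, and the second update overwrites the first.\<close>
    have "f (x(i := y', i := y)) \<le> f (x(i := y')) + ennreal e"
      by (rule insert.prems(2)[OF upd_sp[OF x y'] insertI1 y])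
    then show "f (x(i := y)) \<le> f (x(i := y')) + ennreal e"
      by (simp only: fun_upd_upd)
  qed (use assms f_upd[OF x] in auto)
  \<comment> \<open>Averaging over \<open>i\<close> preserves the bound because
    \<open>unif \<theta>\<^sub>0\<close> has total mass 1 and updates at distinct coordinates
    commute.\<close>
  have h_diff: "h (x(j := y)) \<le> h x + ennreal e"
    if x: "x \<in> space (\<Pi>\<^sub>M i\<in>I. Rplus)" and j: "j \<in> I" and y: "0 \<le> y" for x j y
  proof -
    have "i \<noteq> j" using j insert.hyps by auto
    have "h (x(j := y)) \<le> (\<integral>\<^sup>+ z. f (x(i := z)) + ennreal e \<partial>unif \<theta>\<^sub>0)"
      unfolding h_def
    proof (rule nn_integral_mono)
      fix z assume "z \<in> space (unif \<theta>\<^sub>0)"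
      then have "0 \<le> z" by simp
      then have "f (x(i := z, j := y)) \<le> f (x(i := z)) + ennreal e"
        by (rule insert.prems(2)[OF upd_sp[OF x] insertI2[OF j] y])
      then show "f (x(j := y, i := z)) \<le> f (x(i := z)) + ennreal e"
        by (simp only: fun_upd_twist[OF \<open>i \<noteq> j\<close>])
    qed
    also have "\<dots> = h x + ennreal e"
      using f_upd[OF x] measurable_cong_sets[OF sets_unif refl] U0.emeasure_space_1 unfolding h_def
      by (subst nn_integral_add) auto
    finally show ?thesis .
  qed
  have "(\<integral>\<^sup>+ x. f x \<partial>(\<Pi>\<^sub>M i\<in>insert i I. unif \<theta>\<^sub>1))
      = (\<integral>\<^sup>+ x. (\<integral>\<^sup>+ y. f (x(i := y)) \<partial>unif \<theta>\<^sub>1) \<partial>(\<Pi>\<^sub>M i\<in>I. unif \<theta>\<^sub>1))"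
    using insert.hyps meas by (intro P1.product_nn_integral_insert) auto
  also have "\<dots> \<le> (\<integral>\<^sup>+ x. h x + ennreal ?d \<partial>(\<Pi>\<^sub>M i\<in>I. unif \<theta>\<^sub>1))"
    using inner sets_eq_imp_space_eq[OF sets] by (intro nn_integral_mono) auto
  also have "\<dots> = (\<integral>\<^sup>+ x. h x \<partial>(\<Pi>\<^sub>M i\<in>I. unif \<theta>\<^sub>1)) + ennreal ?d"
    using h_meas1 prob_space.emeasure_space_1[OF P1_prob] by (subst nn_integral_add) auto
  also have "\<dots> \<le> (\<integral>\<^sup>+ x. h x \<partial>(\<Pi>\<^sub>M i\<in>I. unif \<theta>\<^sub>0)) + ennreal (real (card I) * ?d) + ennreal ?d"
    using insert.IH[OF h_meas h_diff] by (intro add_right_mono)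
  also have "(\<integral>\<^sup>+ x. h x \<partial>(\<Pi>\<^sub>M i\<in>I. unif \<theta>\<^sub>0)) = (\<integral>\<^sup>+ x. f x \<partial>(\<Pi>\<^sub>M i\<in>insert i I. unif \<theta>\<^sub>0))"
    unfolding h_def using insert.hyps meas by (intro P0.product_nn_integral_insert[symmetric]) auto
  also have "(\<integral>\<^sup>+ x. f x \<partial>(\<Pi>\<^sub>M i\<in>insert i I. unif \<theta>\<^sub>0)) + ennreal (real (card I) * ?d) + ennreal ?d
      = (\<integral>\<^sup>+ x. f x \<partial>(\<Pi>\<^sub>M i\<in>insert i I. unif \<theta>\<^sub>0)) + ennreal (real (card (insert i I)) * ?d)"
  proof -
    have "ennreal (real (card I) * ?d) + ennreal ?d = ennreal (real (card I) * ?d + ?d)"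
      by (rule ennreal_plus[symmetric, OF mult_nonneg_nonneg[OF of_nat_0_le_iff d] d])
    also have "real (card I) * ?d + ?d = real (card (insert i I)) * ?d"
      using insert.hyps by (simp add: distrib_right)
    finally show ?thesis by (simp add: add.assoc)
  qed
  finally show ?case .
qed

section \<open>The two-point inequality for the risks of a private channel\<close>

text \<open>The test function \<open>\<phi>\<close> rises from 0 at \<open>\<theta>\<^sub>0\<close>
  to 1 at \<open>\<theta>\<^sub>1\<close>, so the error at \<open>\<theta>\<^sub>0\<close> dominates
  \<open>?D * \<phi>\<close> and the error at \<open>\<theta>\<^sub>1\<close> dominates
  \<open>?D * (1 - \<phi>)\<close>. Privacy makes the mean of \<open>\<phi>\<close> nearly equal
  under both parameters. All terms are kept additive, so infinite risks are covered.\<close>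

lemma two_point_risk_bound:
  assumes Q: "Q \<in> tv_private_channels n \<epsilon>" and "0 < \<theta>\<^sub>0" "\<theta>\<^sub>0 < \<theta>\<^sub>1" "0 \<le> \<epsilon>"
  shows "ennreal (\<theta>\<^sub>1 - \<theta>\<^sub>0)
    \<le> risk n Q \<theta>\<^sub>0 + risk n Q \<theta>\<^sub>1 + ennreal ((\<theta>\<^sub>1 - \<theta>\<^sub>0) * (real n * ((1 - \<theta>\<^sub>0 / \<theta>\<^sub>1) * \<epsilon>)))"
proof -
  let ?D = "\<theta>\<^sub>1 - \<theta>\<^sub>0"
  have D: "0 < ?D" using assms by simp
  have Qm: "Q \<in> samples n \<rightarrow>\<^sub>M prob_algebra Rplus" and priv: "tv_private n \<epsilon> Q"
    using Q by (auto simp: tv_private_channels_def channels_def)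
  have Qp: "prob_space (Q x)" "sets (Q x) = sets Rplus" if "x \<in> space (samples n)" for x
    using measurable_space[OF Qm that] by (auto simp: space_prob_algebra)
  \<comment> \<open>Truncating \<open>y - \<theta>\<^sub>0\<close> to \<open>[0, ?D]\<close> rather than testing against the midpoint
    avoids losing a factor 2.\<close>
  define \<phi> where "\<phi> y = max 0 (min 1 ((y - \<theta>\<^sub>0) / ?D))" for y
  have \<phi>01: "0 \<le> \<phi> y \<and> \<phi> y \<le> 1" for y
    by (simp add: \<phi>_def)
  have \<phi>0: "?D * \<phi> y \<le> \<bar>y - \<theta>\<^sub>0\<bar>" and \<phi>1: "?D \<le> ?D * \<phi> y + \<bar>y - \<theta>\<^sub>1\<bar>" for y
    using D by (auto simp: \<phi>_def max_def min_def field_simps)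
  have \<phi>_borel [measurable]: "\<phi> \<in> borel_measurable borel"
    unfolding \<phi>_def by measurable
  have \<phi>_meas: "\<phi> \<in> borel_measurable Rplus"
    unfolding Rplus_def by (rule measurable_restrict_space1) (rule \<phi>_borel)
  have abs_meas: "(\<lambda>y. ennreal \<bar>y - \<theta>\<bar>) \<in> borel_measurable Rplus" for \<theta>
    unfolding Rplus_def by (rule measurable_restrict_space1) measurable
  have Q_meas: "g \<in> borel_measurable (Q x)"
    if "x \<in> space (samples n)" "g \<in> borel_measurable Rplus" for g :: "real \<Rightarrow> 'b::topological_space" and x
    using that Qp(2) measurable_cong_sets by blast
  define f where "f x = (\<integral>\<^sup>+ y. ennreal (\<phi> y) \<partial>Q x)" for x
  have int_meas: "(\<lambda>x. \<integral>\<^sup>+ y. g y \<partial>Q x) \<in> borel_measurable (samples n)"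
    if "g \<in> borel_measurable Rplus" for g
    by (rule measurable_compose[OF measurable_prob_algebraD[OF Qm]
          nn_integral_measurable_subprob_algebra[OF that]])
  have f_meas: "f \<in> borel_measurable (samples n)"
    unfolding f_def using \<phi>_meas by (intro int_meas) auto
  have law_meas: "g \<in> borel_measurable (sample_law n \<theta>)" if "g \<in> borel_measurable (samples n)"
    for g :: "_ \<Rightarrow> ennreal" and \<theta>
    using that measurable_cong_sets[OF sets_sample_law refl] by blast
  have law_space: "space (sample_law n \<theta>) = space (samples n)" for \<theta>
    by (rule sets_eq_imp_space_eq) (rule sets_sample_law)
  have f_diff: "f (x(i := y)) \<le> f x + ennreal \<epsilon>"
    if x: "x \<in> space (samples n)" and i: "i < n" and y: "0 \<le> y" for x i y
  \<comment> \<open>\<open>tv_private\<close> compares samples at exactly one differing index, so an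
    update that changes nothing is treated apart.\<close>
  proof (cases "x i = y")
    case True
    then show ?thesis by (simp add: fun_upd_idem)
  next
    case False
    have upd: "x(i := y) \<in> space (samples n)"
      using x i y by (auto simp: samples_def space_PiM Rplus_def space_restrict_space PiE_def Pi_def extensional_def)
    have "{j\<in>{..<n}. (x(i := y)) j \<noteq> x j} = {i}"
      using i False by auto
    then have "card {j\<in>{..<n}. (x(i := y)) j \<noteq> x j} = 1"
      by simp
    then have "\<bar>measure (Q (x(i := y))) A - measure (Q x) A\<bar> \<le> \<epsilon>" if "A \<in> sets Rplus" for A
      using priv that x upd unfolding tv_private_def by blast
    then have "measure (Q (x(i := y))) A \<le> measure (Q x) A + \<epsilon>" if "A \<in> sets Rplus" for A
      using that by (smt (verit))
    then show ?thesis
      unfolding f_def using Qp[OF x] Qp[OF upd] \<phi>01 \<open>0 \<le> \<epsilon>\<close> Q_meas[OF upd \<phi>_meas]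
      by (intro nn_integral_le_tv) auto
  qed
  have tv: "(\<integral>\<^sup>+ x. f x \<partial>sample_law n \<theta>\<^sub>1)
      \<le> (\<integral>\<^sup>+ x. f x \<partial>sample_law n \<theta>\<^sub>0) + ennreal (real n * ((1 - \<theta>\<^sub>0 / \<theta>\<^sub>1) * \<epsilon>))"
    using nn_integral_PiM_unif_le[of "{..<n}" \<theta>\<^sub>0 \<theta>\<^sub>1 \<epsilon> f] assms f_meas f_diff
    unfolding sample_law_def samples_def by auto
  have risk0: "ennreal ?D * (\<integral>\<^sup>+ x. f x \<partial>sample_law n \<theta>\<^sub>0) \<le> risk n Q \<theta>\<^sub>0"
  proof -
    have "ennreal ?D * f x \<le> (\<integral>\<^sup>+ y. ennreal \<bar>y - \<theta>\<^sub>0\<bar> \<partial>Q x)" if x: "x \<in> space (samples n)" for x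
    proof -
      have "ennreal ?D * f x = (\<integral>\<^sup>+ y. ennreal ?D * ennreal (\<phi> y) \<partial>Q x)"
        unfolding f_def using Q_meas[OF x \<phi>_meas] by (intro nn_integral_cmult[symmetric]) auto
      also have "\<dots> \<le> (\<integral>\<^sup>+ y. ennreal \<bar>y - \<theta>\<^sub>0\<bar> \<partial>Q x)"
        using D \<phi>0 \<phi>01 by (intro nn_integral_mono) (simp add: ennreal_mult[symmetric])
      finally show ?thesis .
    qed
    then have "(\<integral>\<^sup>+ x. ennreal ?D * f x \<partial>sample_law n \<theta>\<^sub>0) \<le> risk n Q \<theta>\<^sub>0"
      unfolding risk_def by (intro nn_integral_mono) (simp add: law_space)
    then show ?thesis
      by (simp add: nn_integral_cmult law_meas f_meas)
  qed
  have risk1: "ennreal ?D \<le> ennreal ?D * (\<integral>\<^sup>+ x. f x \<partial>sample_law n \<theta>\<^sub>1) + risk n Q \<theta>\<^sub>1"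
  proof -
    have le: "ennreal ?D \<le> ennreal ?D * f x + (\<integral>\<^sup>+ y. ennreal \<bar>y - \<theta>\<^sub>1\<bar> \<partial>Q x)"
      if x: "x \<in> space (samples n)" for x
    proof -
      have "ennreal ?D = (\<integral>\<^sup>+ y. ennreal ?D \<partial>Q x)"
        using prob_space.emeasure_space_1[OF Qp(1)[OF x]] by simp
      also have "\<dots> \<le> (\<integral>\<^sup>+ y. ennreal ?D * ennreal (\<phi> y) + ennreal \<bar>y - \<theta>\<^sub>1\<bar> \<partial>Q x)"
      proof (rule nn_integral_mono)
        fix y
        show "ennreal ?D \<le> ennreal ?D * ennreal (\<phi> y) + ennreal \<bar>y - \<theta>\<^sub>1\<bar>"
          using D \<phi>1[of y] \<phi>01[of y]
          by (simp add: ennreal_mult[symmetric] ennreal_plus[symmetric] del: ennreal_plus)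
      qed
      also have "\<dots> = ennreal ?D * f x + (\<integral>\<^sup>+ y. ennreal \<bar>y - \<theta>\<^sub>1\<bar> \<partial>Q x)"
        unfolding f_def using Q_meas[OF x \<phi>_meas] Q_meas[OF x abs_meas]
        by (subst nn_integral_add) (auto intro!: nn_integral_cmult)
      finally show ?thesis .
    qed
    interpret S: prob_space "sample_law n \<theta>\<^sub>1"
      unfolding sample_law_def using assms by (intro prob_space_PiM prob_space_unif) auto
    have "ennreal ?D = (\<integral>\<^sup>+ x. ennreal ?D \<partial>sample_law n \<theta>\<^sub>1)"
      using S.emeasure_space_1 by simp
    also have "\<dots> \<le> (\<integral>\<^sup>+ x. ennreal ?D * f x + (\<integral>\<^sup>+ y. ennreal \<bar>y - \<theta>\<^sub>1\<bar> \<partial>Q x) \<partial>sample_law n \<theta>\<^sub>1)"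
      using le by (intro nn_integral_mono) (simp add: law_space)
    also have "\<dots> = ennreal ?D * (\<integral>\<^sup>+ x. f x \<partial>sample_law n \<theta>\<^sub>1) + risk n Q \<theta>\<^sub>1"
      unfolding risk_def using law_meas[OF f_meas] law_meas[OF int_meas[OF abs_meas]]
      by (subst nn_integral_add) (auto intro!: nn_integral_cmult)
    finally show ?thesis .
  qed
  \<comment> \<open>From the mean of \<open>f\<close> under \<open>\<theta>\<^sub>1\<close>,
    \<open>tv\<close> passes to the mean under \<open>\<theta>\<^sub>0\<close>, which
    \<open>risk0\<close> absorbs into the risk there.\<close>
  note risk1
  also have "ennreal ?D * (\<integral>\<^sup>+ x. f x \<partial>sample_law n \<theta>\<^sub>1)
      \<le> ennreal ?D * (\<integral>\<^sup>+ x. f x \<partial>sample_law n \<theta>\<^sub>0)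
        + ennreal (?D * (real n * ((1 - \<theta>\<^sub>0 / \<theta>\<^sub>1) * \<epsilon>)))"
    using mult_left_mono[OF tv, of "ennreal ?D"] D by (simp add: distrib_left ennreal_mult')
  also have "\<dots> \<le> risk n Q \<theta>\<^sub>0 + ennreal (?D * (real n * ((1 - \<theta>\<^sub>0 / \<theta>\<^sub>1) * \<epsilon>)))"
    using risk0 by (intro add_right_mono)
  finally show ?thesis
    by (simp add: ac_simps)
qed

text \<open>Both \<open>(1 - \<delta>) * t\<close> and \<open>t\<close> lie in
  \<open>{0<..t}\<close>, so the supremum is at least half the sum of their risks.\<close>

lemma SUP_risk_ge:
  assumes Q: "Q \<in> tv_private_channels n \<epsilon>" and "0 < \<delta>" "\<delta> < 1" "0 < t" "0 \<le> \<epsilon>"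
  shows "ennreal (\<delta> * t * (1 - real n * \<epsilon> * \<delta>) / 2) \<le> (SUP \<theta>\<in>{0<..t}. risk n Q \<theta>)"
proof -
  define \<theta>\<^sub>0 where "\<theta>\<^sub>0 = (1 - \<delta>) * t"
  have \<theta>: "0 < \<theta>\<^sub>0" "\<theta>\<^sub>0 < t" "1 - \<theta>\<^sub>0 / t = \<delta>" "t - \<theta>\<^sub>0 = \<delta> * t"
    using assms by (auto simp: \<theta>\<^sub>0_def algebra_simps diff_divide_distrib)
  let ?S = "SUP \<theta>\<in>{0<..t}. risk n Q \<theta>"
  have "ennreal (\<delta> * t) \<le> risk n Q \<theta>\<^sub>0 + risk n Q t + ennreal (\<delta> * t * (real n * (\<delta> * \<epsilon>)))"
    using two_point_risk_bound[OF Q \<theta>(1,2) \<open>0 \<le> \<epsilon>\<close>] by (simp only: \<theta>)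
  also have "\<dots> \<le> ?S + ?S + ennreal (\<delta> * t * (real n * (\<delta> * \<epsilon>)))"
    using \<theta> \<open>0 < t\<close> by (intro add_mono SUP_upper) auto
  finally have le: "ennreal (\<delta> * t) \<le> ?S + ?S + ennreal (\<delta> * t * (real n * (\<delta> * \<epsilon>)))" .
  show ?thesis
  \<comment> \<open>Moving the privacy term to the left needs real subtraction, hence a finite
    supremum; an infinite one is trivial.\<close>
  proof (cases ?S)
    case (real s)
    have "0 \<le> \<delta> * t * (real n * (\<delta> * \<epsilon>))"
      using assms by auto
    then have "\<delta> * t \<le> s + s + \<delta> * t * (real n * (\<delta> * \<epsilon>))"
      using le real by (simp add: ennreal_plus[symmetric] del: ennreal_plus)
    then have "\<delta> * t * (1 - real n * \<epsilon> * \<delta>) / 2 \<le> s"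
      by (simp add: algebra_simps)
    then show ?thesis
      using real by simp
  next
    case top
    show ?thesis unfolding top by simp
  qed
qed

section \<open>The choice of separation and the minimax bound\<close>

text \<open>The lower bound on \<open>n * \<epsilon>\<close> excludes a regime where the inequality
  fails: the constant estimate \<open>t / 2\<close> is perfectly private with worst risk
  \<open>t / 2\<close>, less than the claimed bound once
  \<open>n * \<epsilon> < 1 / 16\<close>.\<close>

theorem proposition3:
  fixes n :: nat and \<epsilon> t :: real
  assumes "n \<ge> 1" and "\<epsilon> > 0" and "t > 0"
    and "real n * \<epsilon> \<ge> 1 / 14"
  shows "(INF Q\<in>tv_private_channels n \<epsilon>. SUP \<theta>\<in>{0<..t}. risk n Q \<theta>)
           \<ge> ennreal (1 / 32 * (t / (real n * \<epsilon>)))"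
proof (rule INF_greatest)
  fix Q assume Q: "Q \<in> tv_private_channels n \<epsilon>"
  define k where "k = real n * \<epsilon>"
  have k: "1 / 14 \<le> k" using assms by (simp add: k_def)
  \<comment> \<open>The target \<open>1 / (16 * k)\<close> is twice \<open>1 / (32 * k)\<close>,
    because \<open>SUP_risk_ge\<close> halves the sum of the two risks.\<close>
  obtain \<delta> where \<delta>: "0 < \<delta>" "\<delta> < 1" "1 / (16 * k) \<le> \<delta> * (1 - k * \<delta>)"
  proof (cases "k \<le> 1 / 2")
    case True
    \<comment> \<open>By convexity \<open>k * k\<close> lies below its chord on
      \<open>[1/14, 1/2]\<close>. The resulting linear lower bound increases in \<open>k\<close>, so
      the endpoint \<open>1/14\<close> decides; there \<open>\<delta>\<close> must be close to 1,
      and \<open>9/10\<close> would already be too small.\<close>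
    have "0 \<le> (k - 1 / 14) * (1 / 2 - k)"
      using k True by simp
    then have "k * k \<le> 4 / 7 * k - 1 / 28"
      by (simp add: field_simps)
    then have "1 / 16 \<le> 19 / 20 * k - 361 / 400 * (k * k)"
      using k by linarith
    also have "\<dots> = k * (19 / 20 * (1 - k * (19 / 20)))"
      by (simp add: field_simps)
    finally have "1 / 16 \<le> k * (19 / 20 * (1 - k * (19 / 20)))" .
    then have "1 / (16 * k) \<le> 19 / 20 * (1 - k * (19 / 20))"
      using k by (simp add: field_simps)
    then show thesis by (intro that[of "19 / 20"]) auto
  next
    case False
    \<comment> \<open>This \<open>\<delta>\<close> maximises
      \<open>\<delta> * (1 - k * \<delta>)\<close>, with value \<open>1 / (4 * k)\<close>; it is
      below 1 exactly because \<open>k > 1/2\<close>.\<close>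
    then show thesis by (intro that[of "1 / (2 * k)"]) (auto simp: field_simps)
  qed
  have "1 / 32 * (t / k) = 1 / (16 * k) * (t / 2)"
    by simp
  also have "\<dots> \<le> \<delta> * (1 - k * \<delta>) * (t / 2)"
    using \<delta>(3) assms by (intro mult_right_mono) auto
  also have "\<dots> = \<delta> * t * (1 - k * \<delta>) / 2"
    by simp
  finally have "ennreal (1 / 32 * (t / k)) \<le> ennreal (\<delta> * t * (1 - k * \<delta>) / 2)"
    by (rule ennreal_leI)
  also have "\<dots> \<le> (SUP \<theta>\<in>{0<..t}. risk n Q \<theta>)"
    unfolding k_def using Q \<delta> assms by (intro SUP_risk_ge) auto
  finally show "ennreal (1 / 32 * (t / (real n * \<epsilon>))) \<le> (SUP \<theta>\<in>{0<..t}. risk n Q \<theta>)"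
    unfolding k_def .
qed

end
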